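(* Consider the four-node network with the setting described in the context. Under serial network and channel decoding at node 4, the achievable rate region $\Lambda_{\text{serial}}$ is the convex hull of all rate pairs $(R_A,R_B)$ satisfying $$R_A \le \mathbb{C}_{1,4}, \qquad R_B \le \mathbb{C}',$$ where $\mathbb{C}_{1,4}=1-H(p_{1,4})$ and $\mathbb{C}'=1-H(p')$ is the capacity of a binary symmetric channel with crossover probability $$p' = [(1-p_{1,3})(1-p_{2,3})+p_{1,3}p_{2,3}]\,p_{3,4} + [p_{1,3}(1-p_{2,3})+(1-p_{1,3})p_{2,3}](1-p_{3,4}).$$
   Context: Network: nodes $1,2,3,4$ with directed links $1\to3$, $1\to4$, $2\to3$, $3\to4$. Each link $i\to j$ is a binary symmetric channel (BSC) with crossover probability $p_{i,j}$: input $X_{i,j}\in\{0,1\}$, output $Y_{i,j}=X_{i,j}\oplus E_{i,j}$ with $\Pr\{E_{i,j}=1\}=p_{i,j}$; the link channels are independent, time invariant and memoryless. $H(p)=-p\log p-(1-p)\log(1-p)$ is the binary entropy function (base 2), and the capacity of a BSC with crossover $p$ is $1-H(p)$. Messages $A$ and $B$ are independent and uniformly distributed on $\{1,\dots,\lfloor 2^{nR_A}\rfloor\}$ and $\{1,\dots,\lfloor 2^{nR_B}\rfloor\}$, with $n$ the common block length (each link is used $n$ times). Node 1 encodes $A$ with a (linear) channel code into $\mathbf{X}_{1,3}(A)=\mathbf{X}_{1,4}(A)\in\{0,1\}^n$ and sends it on both links $1\to3$ and $1\to4$; node 2 encodes $B$ with a (linear) channel code into $\mathbf{X}_{2,3}(B)\in\{0,1\}^n$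 and sends it on link $2\to3$. Node 3 performs no decoding: it transmits $\mathbf{X}_{3,4}=\mathbf{Y}_{1,3}\oplus\mathbf{Y}_{2,3}$ (bitwise XOR). Node 4 must estimate $(\hat A,\hat B)$ from $\mathbf{Y}_{1,4}$ and $\mathbf{Y}_{3,4}$; a rate pair is achievable if $\Pr\{(\hat A,\hat B)\neq(A,B)\}$ can be made arbitrarily small. Serial decoding: node 4 first decodes $A$ from $\mathbf{Y}_{1,4}$, then reconstructs $\mathbf{X}_{1,3}(\hat A)$, forms $\mathbf{Y}_{3,4}\oplus\mathbf{X}_{1,3}(\hat A)$ and decodes $B$ from it. The achievable rate region of a strategy is the set of rate pairs achievable when node 4 uses that strategy. *)

theory Defs
  imports "HOL-Analysis.Analysis"
begin

text \<open>Binary entropy (base 2), with the convention 0 log 0 = 0 (automatic, since 0 * _ = 0).\<close>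
definition bin_entropy :: "real \<Rightarrow> real" where
  "bin_entropy p = - (p * log 2 p) - (1 - p) * log 2 (1 - p)"

definition bsc_capacity :: "real \<Rightarrow> real" where
  "bsc_capacity p = 1 - bin_entropy p"

text \<open>Binary words of length n, i.e. {0,1}^n (True = 1).\<close>
definition bitvecs :: "nat \<Rightarrow> bool list set" where
  "bitvecs n = {xs. length xs = n}"

definition xorv :: "bool list \<Rightarrow> bool list \<Rightarrow> bool list" where
  "xorv xs ys = map2 (\<noteq>) xs ys"

definition bsc_noise_prob :: "real \<Rightarrow> bool list \<Rightarrow> real" where
  "bsc_noise_prob p e = prod_list (map (\<lambda>b. if b then p else 1 - p) e)"

definition num_msgs :: "nat \<Rightarrow> real \<Rightarrow> nat" where
  "num_msgs n R = nat \<lfloor>2 powr (real n * R)\<rfloor>"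

definition serial_decode ::
  "(nat \<Rightarrow> bool list) \<Rightarrow> (bool list \<Rightarrow> nat) \<Rightarrow> (bool list \<Rightarrow> nat)
    \<Rightarrow> bool list \<Rightarrow> bool list \<Rightarrow> nat \<times> nat" where
  "serial_decode f decA decB y14 y34 =
     (let ahat = decA y14 in (ahat, decB (xorv y34 (f ahat))))"

text \<open>Error probability Pr{(A-hat,B-hat) \<noteq> (A,B)} for uniform independent messages A in {1..MA},
  B in {1..MB}, encoders f (node 1, on links 1-3 and 1-4) and g (node 2), node 3 forwarding
  Y13 xor Y23, independent BSC noises on the four links, and serial decoding at node 4.\<close>
definition serial_error_prob ::
  "real \<Rightarrow> real \<Rightarrow> real \<Rightarrow> real \<Rightarrow> nat \<Rightarrow> nat \<Rightarrow> nat \<Rightarrow>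
   (nat \<Rightarrow> bool list) \<Rightarrow> (nat \<Rightarrow> bool list) \<Rightarrow> (bool list \<Rightarrow> nat) \<Rightarrow> (bool list \<Rightarrow> nat) \<Rightarrow> real"
  where
  "serial_error_prob p13 p14 p23 p34 n MA MB f g decA decB =
     (1 / (real MA * real MB)) *
     (\<Sum>a\<in>{1..MA}. \<Sum>b\<in>{1..MB}.
        \<Sum>e13\<in>bitvecs n. \<Sum>e14\<in>bitvecs n. \<Sum>e23\<in>bitvecs n. \<Sum>e34\<in>bitvecs n.
          bsc_noise_prob p13 e13 * bsc_noise_prob p14 e14 *
          bsc_noise_prob p23 e23 * bsc_noise_prob p34 e34 *
          (let y13 = xorv (f a) e13; y14 = xorv (f a) e14; y23 = xorv (g b) e23;
               x34 = xorv y13 y23; y34 = xorv x34 e34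
           in if serial_decode f decA decB y14 y34 \<noteq> (a, b) then 1 else 0))"

definition serial_achievable :: "real \<Rightarrow> real \<Rightarrow> real \<Rightarrow> real \<Rightarrow> real \<times> real \<Rightarrow> bool" where
  "serial_achievable p13 p14 p23 p34 R \<longleftrightarrow>
     0 \<le> fst R \<and> 0 \<le> snd R \<and>
     (\<forall>\<epsilon>>0. \<exists>N. \<forall>n\<ge>N. \<exists>f g decA decB.
        (\<forall>a\<in>{1..num_msgs n (fst R)}. f a \<in> bitvecs n) \<and>
        (\<forall>b\<in>{1..num_msgs n (snd R)}. g b \<in> bitvecs n) \<and>
        serial_error_prob p13 p14 p23 p34 n (num_msgs n (fst R)) (num_msgs n (snd R))
          f g decA decB \<le> \<epsilon>)"

text \<open>Achievable rate region (closure of the set of achievable rate pairs, standard convention).\<close>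
definition serial_region :: "real \<Rightarrow> real \<Rightarrow> real \<Rightarrow> real \<Rightarrow> (real \<times> real) set" where
  "serial_region p13 p14 p23 p34 = closure {R. serial_achievable p13 p14 p23 p34 R}"

end

theory Submission
  imports Defs "HOL-Real_Asymp.Real_Asymp"
begin

text \<open>Under serial decoding the pair is decoded wrongly exactly when one of two single-link
  decoders errs: the decoder of \<open>A\<close> on the BSC with crossover \<open>p14\<close>, or the decoder of \<open>B\<close>
  applied to \<open>Y34 \<oplus> X13(A) = X23(B) \<oplus> e13 \<oplus> e23 \<oplus> e34\<close>, i.e. on a BSC with crossover \<open>p'\<close>.
  So the serial error probability lies between the larger and the sum of the two
  single-channel error probabilities, and the achievable rates form the product of the two
  capacity intervals, which is already convex. The BSC coding theorem is proved directly:
  achievability by a derandomised random code with a threshold decoder, the converse by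
  counting decoding regions, both resting on Chebyshev's bound for the weight of the noise.\<close>

section \<open>Binary words and BSC noise\<close>

lemma bitvecs_lists: "bitvecs n = {xs. set xs \<subseteq> UNIV \<and> length xs = n}"
  by (simp add: bitvecs_def)

lemma finite_bitvecs [simp]: "finite (bitvecs n)"
  unfolding bitvecs_lists by (rule finite_lists_length_eq) simp

lemma card_bitvecs: "card (bitvecs n) = 2 ^ n"
  using card_lists_length_eq[of "UNIV :: bool set" n] by (simp add: bitvecs_lists)

lemma bitvecs_nonempty: "bitvecs n \<noteq> {}"
  using card_bitvecs[of n] by force

lemma bitvecs_0: "bitvecs 0 = {[]}"
  by (auto simp: bitvecs_def)

lemma bitvecs_Suc: "bitvecs (Suc n) = Cons True ` bitvecs n \<union> Cons False ` bitvecs n"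
proof (rule set_eqI)
  fix xs show "xs \<in> bitvecs (Suc n) \<longleftrightarrow> xs \<in> Cons True ` bitvecs n \<union> Cons False ` bitvecs n"
    by (cases xs) (auto simp: bitvecs_def)
qed

lemma sum_bitvecs_Suc:
  "(\<Sum>e\<in>bitvecs (Suc n). F e) = (\<Sum>e\<in>bitvecs n. F (True # e)) + (\<Sum>e\<in>bitvecs n. F (False # e))"
  unfolding bitvecs_Suc by (subst sum.union_disjoint) (auto simp: sum.reindex)

lemma xorv_Nil [simp]: "xorv [] ys = []" "xorv xs [] = []"
  by (auto simp: xorv_def)

lemma xorv_Cons [simp]: "xorv (a # xs) (b # ys) = (a \<noteq> b) # xorv xs ys"
  by (simp add: xorv_def)

lemma length_xorv [simp]: "length (xorv xs ys) = min (length xs) (length ys)"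
  by (simp add: xorv_def)

lemma nth_xorv: "i < length xs \<Longrightarrow> i < length ys \<Longrightarrow> xorv xs ys ! i = (xs ! i \<noteq> ys ! i)"
  by (simp add: xorv_def)

lemma xorv_commute: "xorv x y = xorv y x"
  by (rule nth_equalityI) (auto simp: nth_xorv)

lemma xorv_assoc: "xorv (xorv x y) z = xorv x (xorv y z)"
  by (rule nth_equalityI) (auto simp: nth_xorv)

lemma xorv_cancel_left: "length u = length e \<Longrightarrow> xorv u (xorv u e) = e"
  by (rule nth_equalityI) (auto simp: nth_xorv)

lemma sum_bitvecs_xorv_shift:
  assumes "v \<in> bitvecs n"
  shows "(\<Sum>x\<in>bitvecs n. F (xorv v x)) = (\<Sum>y\<in>bitvecs n. F y)"
  by (rule sum.reindex_bij_witness[where i="xorv v" and j="xorv v"])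
    (use assms in \<open>auto simp: bitvecs_def xorv_cancel_left\<close>)

lemma bsc_noise_prob_Nil [simp]: "bsc_noise_prob p [] = 1"
  by (simp add: bsc_noise_prob_def)

lemma bsc_noise_prob_Cons [simp]:
  "bsc_noise_prob p (b # e) = (if b then p else 1 - p) * bsc_noise_prob p e"
  by (simp add: bsc_noise_prob_def)

lemma bsc_noise_prob_nonneg: "0 \<le> p \<Longrightarrow> p \<le> 1 \<Longrightarrow> 0 \<le> bsc_noise_prob p e"
  by (induction e) auto

lemma sum_bsc_noise_prob: "(\<Sum>e\<in>bitvecs n. bsc_noise_prob p e) = 1"
  by (induction n) (simp_all add: bitvecs_0 sum_bitvecs_Suc flip: sum_distrib_left)

lemma sum_bsc_noise_prob_times: "(\<Sum>e\<in>bitvecs n. bsc_noise_prob p e * c) = c"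
  by (simp add: sum_bsc_noise_prob flip: sum_distrib_right)

definition hamming_weight :: "bool list \<Rightarrow> nat" where
  "hamming_weight e = length (filter id e)"

lemma hamming_weight_simps [simp]:
  "hamming_weight [] = 0" "hamming_weight (True # e) = Suc (hamming_weight e)"
  "hamming_weight (False # e) = hamming_weight e"
  by (auto simp: hamming_weight_def)

lemma hamming_weight_le_length: "hamming_weight e \<le> length e"
  by (simp add: hamming_weight_def)

lemma bsc_noise_prob_hamming_weight:
  "bsc_noise_prob p e = p ^ hamming_weight e * (1 - p) ^ (length e - hamming_weight e)"
proof (induction e)
  case (Cons b e)
  then show ?case
    using hamming_weight_le_length[of e] by (cases b) (auto simp: Suc_diff_le)
qed simp

lemma sum_bsc_noise_prob_hamming_weight:
  "(\<Sum>e\<in>bitvecs n. bsc_noise_prob p e * hamming_weight e) = n * p"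
proof (induction n)
  case (Suc n)
  have "(\<Sum>e\<in>bitvecs (Suc n). bsc_noise_prob p e * hamming_weight e)
      = p * (\<Sum>e\<in>bitvecs n. bsc_noise_prob p e * hamming_weight e)
        + p * (\<Sum>e\<in>bitvecs n. bsc_noise_prob p e)
        + (1 - p) * (\<Sum>e\<in>bitvecs n. bsc_noise_prob p e * hamming_weight e)"
    by (simp add: sum_bitvecs_Suc sum_distrib_left sum.distrib algebra_simps)
  then show ?case
    using Suc by (simp add: sum_bsc_noise_prob algebra_simps)
qed (simp add: bitvecs_0)

lemma sum_bsc_noise_prob_hamming_weight_squared:
  "(\<Sum>e\<in>bitvecs n. bsc_noise_prob p e * (real (hamming_weight e))\<^sup>2) = n * p * (1 - p) + n\<^sup>2 * p\<^sup>2"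
proof (induction n)
  case (Suc n)
  have "(\<Sum>e\<in>bitvecs (Suc n). bsc_noise_prob p e * (real (hamming_weight e))\<^sup>2)
      = p * (\<Sum>e\<in>bitvecs n. bsc_noise_prob p e * (real (hamming_weight e))\<^sup>2)
        + 2 * p * (\<Sum>e\<in>bitvecs n. bsc_noise_prob p e * hamming_weight e)
        + p * (\<Sum>e\<in>bitvecs n. bsc_noise_prob p e)
        + (1 - p) * (\<Sum>e\<in>bitvecs n. bsc_noise_prob p e * (real (hamming_weight e))\<^sup>2)"
    by (simp add: sum_bitvecs_Suc sum_distrib_left sum.distrib power2_eq_square algebra_simps)
  then show ?case
    unfolding Suc.IH sum_bsc_noise_prob_hamming_weight sum_bsc_noise_prob
    by (simp add: power2_eq_square algebra_simps)
qed (simp add: bitvecs_0)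

lemma variance_hamming_weight:
  "(\<Sum>e\<in>bitvecs n. bsc_noise_prob p e * (real (hamming_weight e) - n * p)\<^sup>2) = n * p * (1 - p)"
proof -
  have "(\<Sum>e\<in>bitvecs n. bsc_noise_prob p e * (real (hamming_weight e) - n * p)\<^sup>2)
      = (\<Sum>e\<in>bitvecs n. bsc_noise_prob p e * (real (hamming_weight e))\<^sup>2)
        - 2 * real n * p * (\<Sum>e\<in>bitvecs n. bsc_noise_prob p e * hamming_weight e)
        + (n * p)\<^sup>2 * (\<Sum>e\<in>bitvecs n. bsc_noise_prob p e)"
    by (simp add: power2_eq_square algebra_simps sum_distrib_left sum.distrib sum_subtractf)
  then show ?thesis
    unfolding sum_bsc_noise_prob_hamming_weight_squared sum_bsc_noise_prob_hamming_weight
      sum_bsc_noise_prob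
    by (simp add: power2_eq_square algebra_simps)
qed

definition xor_crossover :: "real \<Rightarrow> real \<Rightarrow> real" where
  "xor_crossover p q = p * (1 - q) + (1 - p) * q"

lemma xor_crossover_bounds:
  assumes "0 \<le> p" "p \<le> 1" "0 \<le> q" "q \<le> 1"
  shows "0 \<le> xor_crossover p q" "xor_crossover p q \<le> 1"
proof -
  have "0 \<le> p * q + (1 - p) * (1 - q)"
    using assms by (intro add_nonneg_nonneg mult_nonneg_nonneg) auto
  moreover have "xor_crossover p q = 1 - (p * q + (1 - p) * (1 - q))"
    by (simp add: xor_crossover_def algebra_simps)
  ultimately show "xor_crossover p q \<le> 1" by simp
  show "0 \<le> xor_crossover p q"
    using assms unfolding xor_crossover_def by (intro add_nonneg_nonneg mult_nonneg_nonneg) auto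
qed

lemma sum_bsc_noise_prob_xorv:
  "(\<Sum>e1\<in>bitvecs n. \<Sum>e2\<in>bitvecs n. bsc_noise_prob p e1 * bsc_noise_prob q e2 * h (xorv e1 e2))
    = (\<Sum>e\<in>bitvecs n. bsc_noise_prob (xor_crossover p q) e * h e)"
proof (induction n arbitrary: h)
  case (Suc n)
  let ?S = "\<lambda>h. \<Sum>e1\<in>bitvecs n. \<Sum>e2\<in>bitvecs n. bsc_noise_prob p e1 * bsc_noise_prob q e2 * h (xorv e1 e2)"
  let ?T = "\<lambda>h. \<Sum>e\<in>bitvecs n. bsc_noise_prob (xor_crossover p q) e * h e"
  define hT where "hT e = h (True # e)" for e
  define hF where "hF e = h (False # e)" for e
  have factor: "(\<Sum>x\<in>A. \<Sum>y\<in>B. (c * f x) * (d * g y) * k x y)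
      = c * d * (\<Sum>x\<in>A. \<Sum>y\<in>B. f x * g y * k x y)" for A B :: "bool list set" and c d :: real and f g k
    unfolding sum_distrib_left by (simp add: mult_ac)
  have "(\<Sum>e1\<in>bitvecs (Suc n). \<Sum>e2\<in>bitvecs (Suc n).
            bsc_noise_prob p e1 * bsc_noise_prob q e2 * h (xorv e1 e2))
      = (\<Sum>e1\<in>bitvecs n. \<Sum>e2\<in>bitvecs n. (p * bsc_noise_prob p e1) * (q * bsc_noise_prob q e2) * hF (xorv e1 e2))
      + (\<Sum>e1\<in>bitvecs n. \<Sum>e2\<in>bitvecs n. (p * bsc_noise_prob p e1) * ((1 - q) * bsc_noise_prob q e2) * hT (xorv e1 e2))
      + ((\<Sum>e1\<in>bitvecs n. \<Sum>e2\<in>bitvecs n. ((1 - p) * bsc_noise_prob p e1) * (q * bsc_noise_prob q e2) * hT (xorv e1 e2))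
      + (\<Sum>e1\<in>bitvecs n. \<Sum>e2\<in>bitvecs n. ((1 - p) * bsc_noise_prob p e1) * ((1 - q) * bsc_noise_prob q e2) * hF (xorv e1 e2)))"
    by (simp add: sum_bitvecs_Suc sum.distrib hT_def hF_def)
  also have "\<dots> = (p * q + (1 - p) * (1 - q)) * ?S hF + (p * (1 - q) + (1 - p) * q) * ?S hT"
    unfolding factor by (simp add: algebra_simps)
  also have "\<dots> = (1 - xor_crossover p q) * ?T hF + xor_crossover p q * ?T hT"
    unfolding Suc.IH by (simp add: xor_crossover_def algebra_simps)
  also have "\<dots> = (\<Sum>e\<in>bitvecs (Suc n). bsc_noise_prob (xor_crossover p q) e * h e)"
    by (simp add: sum_bitvecs_Suc sum_distrib_left hT_def hF_def mult_ac)
  finally show ?case .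
qed (simp add: bitvecs_0)

section \<open>Typical noise\<close>

definition typical :: "real \<Rightarrow> nat \<Rightarrow> real \<Rightarrow> bool list \<Rightarrow> bool" where
  "typical p n \<delta> e \<longleftrightarrow>
     2 powr (- (n * (bin_entropy p + \<delta>))) \<le> bsc_noise_prob p e \<and>
     bsc_noise_prob p e \<le> 2 powr (- (n * (bin_entropy p - \<delta>)))"

definition atypical_prob :: "real \<Rightarrow> nat \<Rightarrow> real \<Rightarrow> real" where
  "atypical_prob p n \<delta> = (\<Sum>e\<in>bitvecs n. bsc_noise_prob p e * of_bool (\<not> typical p n \<delta> e))"

lemma atypical_prob_nonneg: "0 \<le> p \<Longrightarrow> p \<le> 1 \<Longrightarrow> 0 \<le> atypical_prob p n \<delta>"
  unfolding atypical_prob_def by (intro sum_nonneg) (auto simp: bsc_noise_prob_nonneg)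

lemma log_bsc_noise_prob:
  fixes p :: real
  assumes "0 < p" "p < 1" "e \<in> bitvecs n"
  shows "log 2 (bsc_noise_prob p e) + n * bin_entropy p
           = (real (hamming_weight e) - n * p) * (log 2 p - log 2 (1 - p))"
proof -
  have "hamming_weight e \<le> n"
    using hamming_weight_le_length[of e] assms(3) by (simp add: bitvecs_def)
  moreover have "log 2 (bsc_noise_prob p e)
      = hamming_weight e * log 2 p + (n - hamming_weight e) * log 2 (1 - p)"
    using assms by (simp add: bsc_noise_prob_hamming_weight log_mult log_nat_power bitvecs_def)
  ultimately show ?thesis
    by (simp add: bin_entropy_def algebra_simps)
qed

text \<open>Chebyshev's inequality for the Hamming weight: atypicality of the noise forces the
  weight to deviate from its mean \<open>n p\<close> by more than \<open>n \<delta> / L\<close>.\<close>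
lemma atypical_prob_le:
  fixes p :: real
  assumes p: "0 < p" "p < 1" and \<delta>: "\<delta> > 0" and n: "n > 0"
  defines "L \<equiv> log 2 p - log 2 (1 - p)"
  shows "atypical_prob p n \<delta> \<le> L\<^sup>2 * p * (1 - p) / \<delta>\<^sup>2 / n"
proof -
  have pointwise: "bsc_noise_prob p e * of_bool (\<not> typical p n \<delta> e)
      \<le> (L\<^sup>2 / (n * \<delta>)\<^sup>2) * (bsc_noise_prob p e * (real (hamming_weight e) - n * p)\<^sup>2)"
    if e: "e \<in> bitvecs n" for e
  proof (cases "typical p n \<delta> e")
    case False
    have pos: "0 < bsc_noise_prob p e"
      using p by (simp add: bsc_noise_prob_hamming_weight)
    then have "log 2 (bsc_noise_prob p e) < - (n * (bin_entropy p + \<delta>))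
             \<or> - (n * (bin_entropy p - \<delta>)) < log 2 (bsc_noise_prob p e)"
      using False by (auto simp: typical_def powr_le_iff le_powr_iff)
    then have "n * \<delta> < \<bar>(real (hamming_weight e) - n * p) * L\<bar>"
      using log_bsc_noise_prob[OF p e] by (auto simp: L_def algebra_simps)
    then have "(n * \<delta>)\<^sup>2 < \<bar>(real (hamming_weight e) - n * p) * L\<bar>\<^sup>2"
      using \<delta> n by (intro power_strict_mono) auto
    then have "(n * \<delta>)\<^sup>2 < ((real (hamming_weight e) - n * p) * L)\<^sup>2"
      by simp
    then have "1 \<le> ((real (hamming_weight e) - n * p) * L)\<^sup>2 / (n * \<delta>)\<^sup>2"
      using \<delta> n by simp
    then have "bsc_noise_prob p e * 1
        \<le> bsc_noise_prob p e * (((real (hamming_weight e) - n * p) * L)\<^sup>2 / (n * \<delta>)\<^sup>2)"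
      using pos by (intro mult_left_mono) auto
    then show ?thesis
      using False by (simp add: power_mult_distrib mult_ac)
  qed (use p in \<open>simp add: bsc_noise_prob_nonneg\<close>)
  have "atypical_prob p n \<delta>
      \<le> (\<Sum>e\<in>bitvecs n. (L\<^sup>2 / (n * \<delta>)\<^sup>2) * (bsc_noise_prob p e * (real (hamming_weight e) - n * p)\<^sup>2))"
    unfolding atypical_prob_def by (intro sum_mono pointwise)
  also have "\<dots> = (L\<^sup>2 / (n * \<delta>)\<^sup>2) * (n * p * (1 - p))"
    by (simp only: variance_hamming_weight flip: sum_distrib_left)
  also have "\<dots> = L\<^sup>2 * p * (1 - p) / \<delta>\<^sup>2 / n"
    using \<delta> n by (simp add: power2_eq_square field_simps)
  finally show ?thesis .
qed

lemma atypical_prob_zero: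
  assumes "p = 0 \<or> p = 1" "\<delta> > 0"
  shows "atypical_prob p n \<delta> = 0"
  unfolding atypical_prob_def
proof (intro sum.neutral ballI)
  fix e assume "e \<in> bitvecs n"
  have "bin_entropy p = 0"
    using assms by (auto simp: bin_entropy_def)
  moreover have "bsc_noise_prob p e = 0 \<or> bsc_noise_prob p e = 1"
    using assms hamming_weight_le_length[of e]
    by (auto simp: bsc_noise_prob_hamming_weight power_0_left le_less)
  moreover have "2 powr (- (n * \<delta>)) \<le> 2 powr 0" "2 powr 0 \<le> 2 powr (n * \<delta>)"
    using assms(2) by (intro powr_mono; simp)+
  ultimately show "bsc_noise_prob p e * of_bool (\<not> typical p n \<delta> e) = 0"
    by (auto simp: typical_def)
qed

lemma atypical_prob_tendsto_0:
  assumes "0 \<le> p" "p \<le> 1" "\<delta> > 0"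
  shows "(\<lambda>n. atypical_prob p n \<delta>) \<longlonglongrightarrow> 0"
proof (cases "p = 0 \<or> p = 1")
  case True
  then show ?thesis
    using assms by (simp add: atypical_prob_zero)
next
  case False
  with assms have p: "0 < p" "p < 1"
    by auto
  define K where "K = (log 2 p - log 2 (1 - p))\<^sup>2 * p * (1 - p) / \<delta>\<^sup>2"
  have "atypical_prob p n \<delta> \<le> K / n" if "n > 0" for n
    using atypical_prob_le[OF p assms(3) that] by (simp add: K_def)
  then have "eventually (\<lambda>n. atypical_prob p n \<delta> \<le> K / n) sequentially"
    by (intro eventually_mono[OF eventually_gt_at_top[of 0]])
  moreover have "eventually (\<lambda>n. 0 \<le> atypical_prob p n \<delta>) sequentially"
    using assms by (intro always_eventually allI atypical_prob_nonneg)
  ultimately show ?thesis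
    by (intro tendsto_sandwich[OF _ _ tendsto_const lim_const_over_n])
qed

section \<open>Coding over a single BSC\<close>

definition bsc_error_prob ::
  "real \<Rightarrow> nat \<Rightarrow> nat \<Rightarrow> (nat \<Rightarrow> bool list) \<Rightarrow> (bool list \<Rightarrow> nat) \<Rightarrow> real" where
  "bsc_error_prob p n M f d = (1 / M) *
     (\<Sum>a\<in>{1..M}. \<Sum>e\<in>bitvecs n. bsc_noise_prob p e * of_bool (d (xorv (f a) e) \<noteq> a))"

definition good_bsc_code :: "real \<Rightarrow> nat \<Rightarrow> nat \<Rightarrow> real \<Rightarrow> bool" where
  "good_bsc_code p n M \<epsilon> \<longleftrightarrow>
     (\<exists>f d. (\<forall>a\<in>{1..M}. f a \<in> bitvecs n) \<and> bsc_error_prob p n M f d \<le> \<epsilon>)"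

lemma good_bsc_code_mono: "good_bsc_code p n M \<epsilon> \<Longrightarrow> \<epsilon> \<le> \<epsilon>' \<Longrightarrow> good_bsc_code p n M \<epsilon>'"
  unfolding good_bsc_code_def by (meson order.trans)

lemma sum_of_bool_high_prob_le:
  assumes "0 \<le> p" "p \<le> 1" "t > 0"
  shows "(\<Sum>y\<in>bitvecs n. of_bool (t \<le> bsc_noise_prob p y)) \<le> 1 / t"
proof -
  have "t * (\<Sum>y\<in>bitvecs n. of_bool (t \<le> bsc_noise_prob p y))
      = (\<Sum>y\<in>bitvecs n. if t \<le> bsc_noise_prob p y then t else 0)"
    unfolding sum_distrib_left by (intro sum.cong) auto
  also have "\<dots> \<le> (\<Sum>y\<in>bitvecs n. bsc_noise_prob p y)"
    using assms by (intro sum_mono) (auto simp: bsc_noise_prob_nonneg)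
  finally show ?thesis
    using assms by (simp add: sum_bsc_noise_prob field_simps)
qed

lemma sum_decoded_correctly_le:
  fixes f :: "nat \<Rightarrow> bool list" and d :: "bool list \<Rightarrow> nat"
  assumes "\<forall>a\<in>{1..M}. f a \<in> bitvecs n"
  shows "(\<Sum>a\<in>{1..M}. \<Sum>e\<in>bitvecs n. of_bool (d (xorv (f a) e) = a)) \<le> (2 ^ n :: real)"
proof -
  have "(\<Sum>a\<in>{1..M}. \<Sum>e\<in>bitvecs n. of_bool (d (xorv (f a) e) = a))
      = (\<Sum>a\<in>{1..M}. \<Sum>y\<in>bitvecs n. of_bool (d y = a) :: real)"
    using assms by (intro sum.cong refl sum_bitvecs_xorv_shift) auto
  also have "\<dots> = (\<Sum>y\<in>bitvecs n. \<Sum>a\<in>{1..M}. of_bool (d y = a))"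
    by (rule sum.swap)
  also have "\<dots> \<le> (\<Sum>y\<in>bitvecs n. 1)"
    by (intro sum_mono) (simp add: of_bool_def)
  finally show ?thesis
    by (simp add: card_bitvecs)
qed

text \<open>At most \<open>2^n\<close> received words can be decoded correctly, and each typical noise vector
  has probability at most \<open>2 powr (- n (H p - \<delta>))\<close>.\<close>
lemma bsc_error_prob_lower_bound:
  assumes p: "0 \<le> p" "p \<le> 1" and "M > 0" and f: "\<forall>a\<in>{1..M}. f a \<in> bitvecs n"
  shows "1 - bsc_error_prob p n M f d
           \<le> 2 powr (- (n * (bin_entropy p - \<delta>))) * 2 ^ n / M + atypical_prob p n \<delta>"
proof -
  define t where "t = 2 powr (- (n * (bin_entropy p - \<delta>)))"
  define ok where "ok a e = (of_bool (d (xorv (f a) e) = a) :: real)" for a e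
  have "1 - bsc_error_prob p n M f d
      = (1 / M) * (\<Sum>a\<in>{1..M}. \<Sum>e\<in>bitvecs n. bsc_noise_prob p e * ok a e)"
  proof -
    have "(\<Sum>a\<in>{1..M}. \<Sum>e\<in>bitvecs n. bsc_noise_prob p e * of_bool (d (xorv (f a) e) \<noteq> a))
        = (\<Sum>a\<in>{1..M}. \<Sum>e\<in>bitvecs n. bsc_noise_prob p e - bsc_noise_prob p e * ok a e)"
      by (intro sum.cong) (auto simp: ok_def)
    then show ?thesis
      using \<open>M > 0\<close> by (simp add: bsc_error_prob_def sum_subtractf sum_bsc_noise_prob field_simps)
  qed
  also have "\<dots> \<le> (1 / M) * (\<Sum>a\<in>{1..M}. \<Sum>e\<in>bitvecs n.
                    t * ok a e + bsc_noise_prob p e * of_bool (\<not> typical p n \<delta> e))"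
    using p by (intro mult_left_mono sum_mono)
      (auto simp: ok_def t_def typical_def bsc_noise_prob_nonneg)
  also have "\<dots> = (1 / M) * (t * (\<Sum>a\<in>{1..M}. \<Sum>e\<in>bitvecs n. ok a e) + M * atypical_prob p n \<delta>)"
    by (simp add: sum.distrib sum_distrib_left atypical_prob_def)
  also have "\<dots> \<le> (1 / M) * (t * 2 ^ n + M * atypical_prob p n \<delta>)"
    using sum_decoded_correctly_le[OF f, of d] unfolding ok_def t_def
    by (intro mult_left_mono add_right_mono) auto
  also have "\<dots> = t * 2 ^ n / M + atypical_prob p n \<delta>"
    using \<open>M > 0\<close> by (simp add: field_simps)
  finally show ?thesis
    unfolding t_def .
qed

text \<open>The probability that a codeword at offset \<open>v\<close> from the sent one passes the decoding
  threshold \<open>t\<close>.\<close>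
definition confusion_prob :: "real \<Rightarrow> nat \<Rightarrow> real \<Rightarrow> bool list \<Rightarrow> real" where
  "confusion_prob p n t v =
     (\<Sum>e\<in>bitvecs n. bsc_noise_prob p e * of_bool (t \<le> bsc_noise_prob p (xorv v e)))"

definition code_confusion :: "real \<Rightarrow> nat \<Rightarrow> real \<Rightarrow> (nat \<Rightarrow> bool list) \<Rightarrow> nat \<Rightarrow> real" where
  "code_confusion p n t f M =
     (\<Sum>a\<in>{1..M}. \<Sum>a'\<in>{1..M}. if a = a' then 0 else confusion_prob p n t (xorv (f a) (f a')))"

lemma sum_confusion_prob_le:
  assumes p: "0 \<le> p" "p \<le> 1" and "t > 0" and u: "u \<in> bitvecs n"
  shows "(\<Sum>x\<in>bitvecs n. confusion_prob p n t (xorv u x)) \<le> 1 / t"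
proof -
  have "(\<Sum>x\<in>bitvecs n. confusion_prob p n t (xorv u x)) = (\<Sum>v\<in>bitvecs n. confusion_prob p n t v)"
    using u by (rule sum_bitvecs_xorv_shift)
  also have "\<dots> = (\<Sum>e\<in>bitvecs n. bsc_noise_prob p e *
                     (\<Sum>v\<in>bitvecs n. of_bool (t \<le> bsc_noise_prob p (xorv e v))))"
    unfolding confusion_prob_def sum_distrib_left by (subst sum.swap) (simp add: xorv_commute)
  also have "\<dots> = (\<Sum>e\<in>bitvecs n. bsc_noise_prob p e *
                     (\<Sum>y\<in>bitvecs n. of_bool (t \<le> bsc_noise_prob p y)))"
    by (intro sum.cong refl arg_cong2[where f="(*)"] sum_bitvecs_xorv_shift)
  also have "\<dots> \<le> (\<Sum>e\<in>bitvecs n. bsc_noise_prob p e * (1 / t))"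
    using sum_of_bool_high_prob_le[OF p \<open>t > 0\<close>]
    by (intro sum_mono mult_left_mono) (auto simp: bsc_noise_prob_nonneg[OF p])
  finally show ?thesis
    by (simp add: sum_bsc_noise_prob flip: sum_divide_distrib)
qed

lemma obtain_le_average:
  fixes g :: "'a \<Rightarrow> real" and B :: real
  assumes "finite S" "S \<noteq> {}" "(\<Sum>x\<in>S. g x) \<le> card S * B"
  obtains x where "x \<in> S" "g x \<le> B"
proof (rule ccontr)
  assume "\<not> thesis"
  with that have "(\<Sum>x\<in>S. B) < (\<Sum>x\<in>S. g x)"
    using assms by (intro sum_strict_mono) force+
  with assms show False
    by simp
qed

lemma code_confusion_extend:
  fixes f :: "nat \<Rightarrow> bool list"
  assumes "x \<in> bitvecs n" "\<forall>a\<in>{1..M}. f a \<in> bitvecs n"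
  shows "code_confusion p n t (f(Suc M := x)) (Suc M)
           = code_confusion p n t f M + 2 * (\<Sum>a\<in>{1..M}. confusion_prob p n t (xorv (f a) x))"
proof -
  let ?f = "f(Suc M := x)"
  let ?c = "confusion_prob p n t"
  define G where "G h a a' = (if a = a' then 0 else ?c (xorv (h a) (h a')))" for h :: "nat \<Rightarrow> bool list" and a a'
  have insert: "{1..Suc M} = insert (Suc M) {1..M}"
    by auto
  have new_row: "(\<Sum>a'\<in>{1..Suc M}. G ?f (Suc M) a') = (\<Sum>a'\<in>{1..M}. ?c (xorv (f a') x))"
    unfolding insert G_def by (simp add: xorv_commute[of x])
  have old_row: "(\<Sum>a'\<in>{1..Suc M}. G ?f a a') = ?c (xorv (f a) x) + (\<Sum>a'\<in>{1..M}. G f a a')"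
    if "a \<in> {1..M}" for a
  proof -
    have "(\<Sum>a'\<in>{1..M}. G ?f a a') = (\<Sum>a'\<in>{1..M}. G f a a')"
      using that by (intro sum.cong) (auto simp: G_def)
    then show ?thesis
      using that unfolding insert by (simp add: G_def)
  qed
  have "code_confusion p n t ?f (Suc M)
      = (\<Sum>a'\<in>{1..M}. ?c (xorv (f a') x)) + (\<Sum>a\<in>{1..M}. \<Sum>a'\<in>{1..Suc M}. G ?f a a')"
    unfolding code_confusion_def G_def[symmetric] new_row[symmetric]
    by (subst insert) simp
  also have "\<dots> = (\<Sum>a'\<in>{1..M}. ?c (xorv (f a') x))
                  + (\<Sum>a\<in>{1..M}. ?c (xorv (f a) x) + (\<Sum>a'\<in>{1..M}. G f a a'))"
    using old_row by simp
  also have "\<dots> = code_confusion p n t f M + 2 * (\<Sum>a\<in>{1..M}. ?c (xorv (f a) x))"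
    by (simp add: code_confusion_def G_def sum.distrib)
  finally show ?thesis .
qed

text \<open>Derandomised random coding: codewords are added one at a time, each chosen at most as
  confusable with the earlier ones as a uniformly random word is on average.\<close>
lemma exists_code_with_small_confusion:
  assumes p: "0 \<le> p" "p \<le> 1" and t: "t > 0"
  shows "\<exists>f. (\<forall>a\<in>{1..M}. f a \<in> bitvecs n) \<and>
             code_confusion p n t f M \<le> real M * (real M - 1) / (t * 2 ^ n)"
proof (induction M)
  case 0
  show ?case
    by (simp add: code_confusion_def)
next
  case (Suc M)
  then obtain f where f: "\<forall>a\<in>{1..M}. f a \<in> bitvecs n"
    and c: "code_confusion p n t f M \<le> real M * (real M - 1) / (t * 2 ^ n)"
    by blast
  define g where "g x = (\<Sum>a\<in>{1..M}. confusion_prob p n t (xorv (f a) x))" for x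
  have "(\<Sum>x\<in>bitvecs n. g x) \<le> (\<Sum>a\<in>{1..M}. 1 / t)"
    unfolding g_def using f by (subst sum.swap) (intro sum_mono sum_confusion_prob_le p t; simp)
  also have "\<dots> = card (bitvecs n) * (M / (t * 2 ^ n))"
    by (simp add: card_bitvecs)
  finally obtain x where x: "x \<in> bitvecs n" "g x \<le> M / (t * 2 ^ n)"
    by (rule obtain_le_average[OF finite_bitvecs bitvecs_nonempty])
  have "code_confusion p n t (f(Suc M := x)) (Suc M) = code_confusion p n t f M + 2 * g x"
    unfolding g_def using x(1) f by (rule code_confusion_extend)
  also have "\<dots> \<le> real M * (real M - 1) / (t * 2 ^ n) + 2 * (M / (t * 2 ^ n))"
    using c x(2) by simp
  also have "\<dots> = real (Suc M) * (real (Suc M) - 1) / (t * 2 ^ n)"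
    using t by (simp add: field_simps)
  finally have "code_confusion p n t (f(Suc M := x)) (Suc M)
      \<le> real (Suc M) * (real (Suc M) - 1) / (t * 2 ^ n)" .
  moreover have "\<forall>a\<in>{1..Suc M}. (f(Suc M := x)) a \<in> bitvecs n"
    using f x(1) by auto
  ultimately show ?case
    by blast
qed

definition threshold_decoder ::
  "real \<Rightarrow> real \<Rightarrow> (nat \<Rightarrow> bool list) \<Rightarrow> nat \<Rightarrow> bool list \<Rightarrow> nat" where
  "threshold_decoder p t f M y =
     (if \<exists>a\<in>{1..M}. t \<le> bsc_noise_prob p (xorv y (f a))
      then LEAST a. a \<in> {1..M} \<and> t \<le> bsc_noise_prob p (xorv y (f a)) else 0)"

lemma threshold_decoder_error_le:
  assumes "a \<in> {1..M}" "f a \<in> bitvecs n" "e \<in> bitvecs n"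
  shows "of_bool (threshold_decoder p t f M (xorv (f a) e) \<noteq> a)
           \<le> of_bool (bsc_noise_prob p e < t)
             + (\<Sum>a'\<in>{1..M}. if a = a' then 0
                  else of_bool (t \<le> bsc_noise_prob p (xorv (xorv (f a) (f a')) e)) :: real)"
    (is "?err \<le> ?improbable + ?competitors")
proof (cases "\<exists>a'\<in>{1..M}. a' \<noteq> a \<and> t \<le> bsc_noise_prob p (xorv (xorv (f a) e) (f a'))")
  case True
  then obtain a' where a': "a' \<in> {1..M}" "a' \<noteq> a"
    "t \<le> bsc_noise_prob p (xorv (xorv (f a) (f a')) e)"
    by (auto simp: xorv_assoc xorv_commute[of e])
  then have "1 \<le> ?competitors"
    by (intro member_le_sum[of a', THEN order.trans[rotated]]) (auto intro: sum_nonneg)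
  then show ?thesis
    by simp
next
  case False
  have cancel: "xorv (xorv (f a) e) (f a) = e"
    using assms by (simp add: xorv_assoc xorv_commute[of e] xorv_cancel_left bitvecs_def)
  have "0 \<le> ?competitors"
    by (intro sum_nonneg) auto
  moreover have "threshold_decoder p t f M (xorv (f a) e) = a" if "t \<le> bsc_noise_prob p e"
  proof -
    have "a \<in> {1..M} \<and> t \<le> bsc_noise_prob p (xorv (xorv (f a) e) (f a))"
      using assms(1) that cancel by simp
    moreover from this have "(LEAST a'. a' \<in> {1..M} \<and> t \<le> bsc_noise_prob p (xorv (xorv (f a) e) (f a'))) = a"
      using False by (intro Least_equality) auto
    ultimately show ?thesis
      unfolding threshold_decoder_def by auto
  qed
  ultimately show ?thesis
    by (cases "bsc_noise_prob p e < t") auto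
qed

lemma bsc_error_prob_threshold_decoder:
  fixes \<delta> :: real
  assumes p: "0 \<le> p" "p \<le> 1" and "M > 0" and f: "\<forall>a\<in>{1..M}. f a \<in> bitvecs n"
  defines "t \<equiv> 2 powr (- (n * (bin_entropy p + \<delta>)))"
  shows "bsc_error_prob p n M f (threshold_decoder p t f M)
           \<le> atypical_prob p n \<delta> + code_confusion p n t f M / M"
proof -
  let ?d = "threshold_decoder p t f M"
  let ?competitor = "\<lambda>a a' e. if a = a' then 0
        else of_bool (t \<le> bsc_noise_prob p (xorv (xorv (f a) (f a')) e)) :: real"
  have "(\<Sum>a\<in>{1..M}. \<Sum>e\<in>bitvecs n. bsc_noise_prob p e * of_bool (?d (xorv (f a) e) \<noteq> a))
      \<le> (\<Sum>a\<in>{1..M}. \<Sum>e\<in>bitvecs n. bsc_noise_prob p e *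
           (of_bool (\<not> typical p n \<delta> e) + (\<Sum>a'\<in>{1..M}. ?competitor a a' e)))"
  proof (intro sum_mono mult_left_mono bsc_noise_prob_nonneg p)
    fix a e assume a: "a \<in> {1..M}" and e: "e \<in> bitvecs n"
    have "of_bool (bsc_noise_prob p e < t) \<le> (of_bool (\<not> typical p n \<delta> e) :: real)"
      by (auto simp: typical_def t_def)
    moreover have "f a \<in> bitvecs n"
      using f a by blast
    note threshold_decoder_error_le[where f=f and p=p and t=t, OF a this e]
    ultimately show "of_bool (?d (xorv (f a) e) \<noteq> a)
        \<le> of_bool (\<not> typical p n \<delta> e) + (\<Sum>a'\<in>{1..M}. ?competitor a a' e)"
      by linarith
  qed
  also have "\<dots> = (\<Sum>a\<in>{1..M}. atypical_prob p n \<delta>)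
      + (\<Sum>a\<in>{1..M}. \<Sum>a'\<in>{1..M}. \<Sum>e\<in>bitvecs n. bsc_noise_prob p e * ?competitor a a' e)"
    unfolding distrib_left sum.distrib atypical_prob_def
    by (simp add: sum_distrib_left sum.swap[of _ "bitvecs n"])
  also have "\<dots> = M * atypical_prob p n \<delta> + code_confusion p n t f M"
  proof -
    have "(\<Sum>e\<in>bitvecs n. bsc_noise_prob p e * ?competitor a a' e)
        = (if a = a' then 0 else confusion_prob p n t (xorv (f a) (f a')))" for a a'
      by (cases "a = a'") (simp_all add: confusion_prob_def)
    then show ?thesis
      by (simp add: code_confusion_def)
  qed
  finally show ?thesis
    using \<open>M > 0\<close> by (simp add: bsc_error_prob_def field_simps)
qed

lemma good_bsc_code_upper_bound:
  assumes p: "0 \<le> p" "p \<le> 1" and "M > 0"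
  shows "good_bsc_code p n M
           (atypical_prob p n \<delta> + M / (2 powr (- (n * (bin_entropy p + \<delta>))) * 2 ^ n))"
proof -
  define t where "t = 2 powr (- (n * (bin_entropy p + \<delta>)))"
  have t: "t > 0"
    by (simp add: t_def)
  obtain f where f: "\<forall>a\<in>{1..M}. f a \<in> bitvecs n"
    and small: "code_confusion p n t f M \<le> real M * (real M - 1) / (t * 2 ^ n)"
    using exists_code_with_small_confusion[OF p t] by blast
  have "code_confusion p n t f M / M \<le> (real M - 1) / (t * 2 ^ n)"
    using small \<open>M > 0\<close> by (simp add: field_simps)
  also have "\<dots> \<le> M / (t * 2 ^ n)"
    using t by (intro divide_right_mono) auto
  finally have "bsc_error_prob p n M f (threshold_decoder p t f M)
      \<le> atypical_prob p n \<delta> + M / (t * 2 ^ n)"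
    using bsc_error_prob_threshold_decoder[OF p \<open>M > 0\<close> f, of \<delta>, folded t_def] by linarith
  then show ?thesis
    using f unfolding good_bsc_code_def t_def by blast
qed

lemma tendsto_powr_neg_linear: "\<delta> > 0 \<Longrightarrow> (\<lambda>n. 2 powr (- (real n * \<delta>))) \<longlonglongrightarrow> 0"
  by real_asymp

lemma one_le_powr_rate: "0 \<le> R \<Longrightarrow> 1 \<le> 2 powr (real n * R)"
  using powr_mono[of 0 "real n * R" "2 :: real"] by simp

lemma num_msgs_pos: "0 \<le> R \<Longrightarrow> 0 < num_msgs n R"
  using one_le_powr_rate[of R n] by (simp add: num_msgs_def)

lemma num_msgs_le: "0 \<le> R \<Longrightarrow> real (num_msgs n R) \<le> 2 powr (real n * R)"
  using one_le_powr_rate[of R n] by (simp add: num_msgs_def)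

lemma num_msgs_ge:
  assumes "0 \<le> R"
  shows "2 powr (real n * R) / 2 \<le> real (num_msgs n R)"
proof -
  let ?x = "2 powr (real n * R)"
  have "?x - 1 < of_int \<lfloor>?x\<rfloor>" "1 \<le> \<lfloor>?x\<rfloor>"
    using one_le_powr_rate[OF assms, of n] by (linarith, simp)
  then have "?x / 2 \<le> of_int \<lfloor>?x\<rfloor>"
    by linarith
  then show ?thesis
    using \<open>1 \<le> \<lfloor>?x\<rfloor>\<close> by (simp add: num_msgs_def)
qed

lemma good_bsc_code_rate_zero: "\<epsilon> \<ge> 0 \<Longrightarrow> good_bsc_code p n (num_msgs n 0) \<epsilon>"
  unfolding good_bsc_code_def num_msgs_def
  by (intro exI[of _ "\<lambda>_. replicate n False"] exI[of _ "\<lambda>_. 1"])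
    (simp add: bsc_error_prob_def bitvecs_def)

lemma good_bsc_code_below_capacity:
  assumes p: "0 \<le> p" "p \<le> 1" and R: "0 \<le> R" "R < bsc_capacity p" and "\<epsilon> > 0"
  shows "\<forall>\<^sub>F n in sequentially. good_bsc_code p n (num_msgs n R) \<epsilon>"
proof -
  define \<delta> where "\<delta> = (bsc_capacity p - R) / 2"
  have \<delta>: "\<delta> > 0"
    using R by (simp add: \<delta>_def)
  have H: "bin_entropy p = 1 - R - 2 * \<delta>"
    unfolding \<delta>_def bsc_capacity_def by (simp add: field_simps)
  have "\<forall>\<^sub>F n in sequentially. atypical_prob p n \<delta> < \<epsilon> / 2 \<and> 2 powr (- (n * \<delta>)) < \<epsilon> / 2"
    using \<open>\<epsilon> > 0\<close> atypical_prob_tendsto_0[OF p \<delta>] tendsto_powr_neg_linear[OF \<delta>]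
    by (intro eventually_conj order_tendstoD(2)) auto
  then show ?thesis
  proof eventually_elim
    case (elim n)
    have "real (num_msgs n R) / (2 powr (- (n * (bin_entropy p + \<delta>))) * 2 ^ n)
        \<le> 2 powr (n * R) / (2 powr (- (n * (bin_entropy p + \<delta>))) * 2 powr n)"
      using num_msgs_le[OF R(1), of n] by (simp add: powr_realpow divide_right_mono)
    also have "\<dots> = 2 powr (n * R + n * (bin_entropy p + \<delta>) - n)"
      by (simp add: powr_add powr_diff powr_minus field_simps)
    also have "\<dots> = 2 powr (- (n * \<delta>))"
      unfolding H by (simp add: algebra_simps)
    finally have "real (num_msgs n R) / (2 powr (- (n * (bin_entropy p + \<delta>))) * 2 ^ n) < \<epsilon> / 2"
      using elim by linarith
    then show ?case
      using elim
      by (intro good_bsc_code_mono[OF good_bsc_code_upper_bound[OF p num_msgs_pos[OF R(1)],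
            where \<delta>=\<delta>]]) linarith
  qed
qed

lemma rate_le_bsc_capacity:
  assumes p: "0 \<le> p" "p \<le> 1" and "0 \<le> R"
    and good: "\<exists>\<^sub>F n in sequentially. good_bsc_code p n (num_msgs n R) (1 / 2)"
  shows "R \<le> bsc_capacity p"
proof (rule ccontr)
  assume "\<not> R \<le> bsc_capacity p"
  define \<delta> where "\<delta> = (R - bsc_capacity p) / 2"
  have \<delta>: "\<delta> > 0"
    using \<open>\<not> R \<le> bsc_capacity p\<close> by (simp add: \<delta>_def)
  have H: "bin_entropy p = 1 - R + 2 * \<delta>"
    unfolding \<delta>_def bsc_capacity_def by (simp add: field_simps)
  have "\<forall>\<^sub>F n in sequentially. atypical_prob p n \<delta> < 1 / 8 \<and> 2 powr (- (n * \<delta>)) < 1 / 8"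
    using atypical_prob_tendsto_0[OF p \<delta>] tendsto_powr_neg_linear[OF \<delta>]
    by (intro eventually_conj order_tendstoD(2)) auto
  from frequently_eventually_conj[OF good this] obtain n where
    small: "atypical_prob p n \<delta> < 1 / 8" "2 powr (- (n * \<delta>)) < 1 / 8"
    and "good_bsc_code p n (num_msgs n R) (1 / 2)"
    by (auto dest: frequently_ex)
  then obtain f d where f: "\<forall>a\<in>{1..num_msgs n R}. f a \<in> bitvecs n"
    and err: "bsc_error_prob p n (num_msgs n R) f d \<le> 1 / 2"
    unfolding good_bsc_code_def by blast
  define M where "M = num_msgs n R"
  have M: "2 powr (n * R) / 2 \<le> M" "0 < M"
    using num_msgs_ge[OF \<open>0 \<le> R\<close>] num_msgs_pos[OF \<open>0 \<le> R\<close>] by (auto simp: M_def)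
  have "2 powr (- (n * (bin_entropy p - \<delta>))) * 2 ^ n / M
      \<le> 2 powr (- (n * (bin_entropy p - \<delta>))) * 2 ^ n / (2 powr (n * R) / 2)"
    using M by (intro divide_left_mono) auto
  also have "\<dots> = 2 * 2 powr (n - n * (bin_entropy p - \<delta>) - n * R)"
    by (simp add: powr_add powr_diff powr_minus field_simps flip: powr_realpow)
  also have "\<dots> = 2 * 2 powr (- (n * \<delta>))"
    unfolding H by (simp add: algebra_simps)
  finally have "1 - bsc_error_prob p n M f d < 2 * (1 / 8) + 1 / 8"
    using bsc_error_prob_lower_bound[OF p M(2) f[folded M_def], of d \<delta>] small by linarith
  then show False
    using err by (simp add: M_def)
qed

section \<open>The four-node network\<close>

definition network_expectation ::
  "real \<Rightarrow> real \<Rightarrow> real \<Rightarrow> real \<Rightarrow> nat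
    \<Rightarrow> (bool list \<Rightarrow> bool list \<Rightarrow> bool list \<Rightarrow> bool list \<Rightarrow> real) \<Rightarrow> real" where
  "network_expectation p13 p14 p23 p34 n F =
     (\<Sum>e13\<in>bitvecs n. \<Sum>e14\<in>bitvecs n. \<Sum>e23\<in>bitvecs n. \<Sum>e34\<in>bitvecs n.
        bsc_noise_prob p13 e13 * bsc_noise_prob p14 e14 * bsc_noise_prob p23 e23 *
        bsc_noise_prob p34 e34 * F e13 e14 e23 e34)"

lemma network_expectation_mono:
  assumes "0 \<le> p13" "p13 \<le> 1" "0 \<le> p14" "p14 \<le> 1" "0 \<le> p23" "p23 \<le> 1" "0 \<le> p34" "p34 \<le> 1"
    and "\<And>e13 e14 e23 e34. e13 \<in> bitvecs n \<Longrightarrow> e14 \<in> bitvecs n \<Longrightarrow> e23 \<in> bitvecs n \<Longrightarrow>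
           e34 \<in> bitvecs n \<Longrightarrow> F e13 e14 e23 e34 \<le> G e13 e14 e23 e34"
  shows "network_expectation p13 p14 p23 p34 n F \<le> network_expectation p13 p14 p23 p34 n G"
  unfolding network_expectation_def using assms
  by (intro sum_mono mult_left_mono) (auto intro!: mult_nonneg_nonneg bsc_noise_prob_nonneg)

lemma network_expectation_add:
  "network_expectation p13 p14 p23 p34 n (\<lambda>e13 e14 e23 e34. F e13 e14 e23 e34 + G e13 e14 e23 e34)
     = network_expectation p13 p14 p23 p34 n F + network_expectation p13 p14 p23 p34 n G"
  by (simp add: network_expectation_def distrib_left sum.distrib)

lemma network_expectation_direct_link:
  "network_expectation p13 p14 p23 p34 n (\<lambda>e13 e14 e23 e34. h e14)
     = (\<Sum>e\<in>bitvecs n. bsc_noise_prob p14 e * h e)"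
proof -
  have "network_expectation p13 p14 p23 p34 n (\<lambda>e13 e14 e23 e34. h e14)
      = (\<Sum>e13\<in>bitvecs n. bsc_noise_prob p13 e13 * (\<Sum>e14\<in>bitvecs n. bsc_noise_prob p14 e14 * h e14 *
           (\<Sum>e23\<in>bitvecs n. bsc_noise_prob p23 e23 * (\<Sum>e34\<in>bitvecs n. bsc_noise_prob p34 e34))))"
    by (simp add: network_expectation_def sum_distrib_left mult_ac)
  then show ?thesis
    by (simp add: sum_bsc_noise_prob sum_bsc_noise_prob_times flip: sum_distrib_left)
qed

text \<open>The relay forwards \<open>Y13 \<oplus> Y23\<close>, so the word at node 4 is corrupted by
  \<open>e13 \<oplus> e23 \<oplus> e34\<close>: a single BSC whose crossover probability is the iterated
  \<open>xor_crossover\<close>.\<close>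
lemma network_expectation_relay:
  "network_expectation p13 p14 p23 p34 n (\<lambda>e13 e14 e23 e34. h (xorv (xorv e13 e23) e34))
     = (\<Sum>e\<in>bitvecs n. bsc_noise_prob (xor_crossover (xor_crossover p13 p23) p34) e * h e)"
proof -
  define k where "k x = (\<Sum>e34\<in>bitvecs n. bsc_noise_prob p34 e34 * h (xorv x e34))" for x
  have "network_expectation p13 p14 p23 p34 n (\<lambda>e13 e14 e23 e34. h (xorv (xorv e13 e23) e34))
      = (\<Sum>e14\<in>bitvecs n. bsc_noise_prob p14 e14 *
           (\<Sum>e13\<in>bitvecs n. \<Sum>e23\<in>bitvecs n. bsc_noise_prob p13 e13 * bsc_noise_prob p23 e23 * k (xorv e13 e23)))"
    unfolding network_expectation_def k_def
    by (subst sum.swap) (simp add: sum_distrib_left mult_ac)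
  also have "\<dots> = (\<Sum>x\<in>bitvecs n. bsc_noise_prob (xor_crossover p13 p23) x * k x)"
    by (simp add: sum_bsc_noise_prob_xorv sum_bsc_noise_prob flip: sum_distrib_right)
  also have "\<dots> = (\<Sum>x\<in>bitvecs n. \<Sum>e34\<in>bitvecs n.
      bsc_noise_prob (xor_crossover p13 p23) x * bsc_noise_prob p34 e34 * h (xorv x e34))"
    by (simp add: k_def sum_distrib_left mult_ac)
  also have "\<dots> = (\<Sum>e\<in>bitvecs n. bsc_noise_prob (xor_crossover (xor_crossover p13 p23) p34) e * h e)"
    by (rule sum_bsc_noise_prob_xorv)
  finally show ?thesis .
qed

lemma serial_decode_error_iff:
  assumes "f a \<in> bitvecs n" "g b \<in> bitvecs n" "e13 \<in> bitvecs n" "e23 \<in> bitvecs n" "e34 \<in> bitvecs n"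
  shows "serial_decode f decA decB (xorv (f a) e14)
           (xorv (xorv (xorv (f a) e13) (xorv (g b) e23)) e34) \<noteq> (a, b)
     \<longleftrightarrow> decA (xorv (f a) e14) \<noteq> a \<or> decB (xorv (g b) (xorv (xorv e13 e23) e34)) \<noteq> b"
proof -
  have "xorv (xorv (xorv (xorv (f a) e13) (xorv (g b) e23)) e34) (f a)
      = xorv (g b) (xorv (xorv e13 e23) e34)"
    using assms by (intro nth_equalityI) (auto simp: bitvecs_def nth_xorv)
  then show ?thesis
    by (auto simp: serial_decode_def Let_def)
qed

lemma serial_error_prob_eq:
  assumes "\<forall>a\<in>{1..MA}. f a \<in> bitvecs n" "\<forall>b\<in>{1..MB}. g b \<in> bitvecs n"
  shows "serial_error_prob p13 p14 p23 p34 n MA MB f g decA decB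
    = 1 / (MA * MB) * (\<Sum>a\<in>{1..MA}. \<Sum>b\<in>{1..MB}. network_expectation p13 p14 p23 p34 n
        (\<lambda>e13 e14 e23 e34. max (of_bool (decA (xorv (f a) e14) \<noteq> a))
                               (of_bool (decB (xorv (g b) (xorv (xorv e13 e23) e34)) \<noteq> b))))"
proof -
  have "(if serial_decode f decA decB (xorv (f a) e14)
            (xorv (xorv (xorv (f a) e13) (xorv (g b) e23)) e34) \<noteq> (a, b) then 1 else 0)
      = max (of_bool (decA (xorv (f a) e14) \<noteq> a))
            (of_bool (decB (xorv (g b) (xorv (xorv e13 e23) e34)) \<noteq> b) :: real)"
    if "a \<in> {1..MA}" "b \<in> {1..MB}" "e13 \<in> bitvecs n" "e23 \<in> bitvecs n" "e34 \<in> bitvecs n"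
    for a b e13 e14 e23 e34
    using serial_decode_error_iff[of f a n g b e13 e23 e34 decA decB e14] that assms by auto
  then show ?thesis
    unfolding serial_error_prob_def network_expectation_def Let_def
    by (intro arg_cong2[where f="(*)"] sum.cong refl) simp
qed

lemma double_average_bounds:
  fixes u :: "'a \<Rightarrow> real" and v :: "'b \<Rightarrow> real"
  assumes "finite A" "A \<noteq> {}" "finite B" "B \<noteq> {}"
    and "\<And>a b. a \<in> A \<Longrightarrow> b \<in> B \<Longrightarrow> u a \<le> w a b \<and> v b \<le> w a b \<and> w a b \<le> u a + v b"
  defines "avg \<equiv> (\<Sum>a\<in>A. \<Sum>b\<in>B. w a b) / (card A * card B)"
  shows "(\<Sum>a\<in>A. u a) / card A \<le> avg" "(\<Sum>b\<in>B. v b) / card B \<le> avg"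
    and "avg \<le> (\<Sum>a\<in>A. u a) / card A + (\<Sum>b\<in>B. v b) / card B"
proof -
  have pos: "card A > 0" "card B > 0"
    using assms by (simp_all add: card_gt_0_iff)
  have "(\<Sum>a\<in>A. \<Sum>b\<in>B. u a) \<le> (\<Sum>a\<in>A. \<Sum>b\<in>B. w a b)"
    using assms by (intro sum_mono) auto
  then show "(\<Sum>a\<in>A. u a) / card A \<le> avg"
    using pos by (simp add: avg_def field_simps flip: sum_distrib_right)
  have "(\<Sum>a\<in>A. \<Sum>b\<in>B. v b) \<le> (\<Sum>a\<in>A. \<Sum>b\<in>B. w a b)"
    using assms by (intro sum_mono) auto
  then show "(\<Sum>b\<in>B. v b) / card B \<le> avg"
    using pos by (simp add: avg_def field_simps flip: sum_distrib_right)
  have "(\<Sum>a\<in>A. \<Sum>b\<in>B. w a b) \<le> (\<Sum>a\<in>A. \<Sum>b\<in>B. u a + v b)"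
    using assms by (intro sum_mono) auto
  then show "avg \<le> (\<Sum>a\<in>A. u a) / card A + (\<Sum>b\<in>B. v b) / card B"
    using pos by (simp add: avg_def sum.distrib field_simps flip: sum_distrib_right)
qed

lemma serial_error_prob_bounds:
  assumes p: "0 \<le> p13" "p13 \<le> 1" "0 \<le> p14" "p14 \<le> 1" "0 \<le> p23" "p23 \<le> 1" "0 \<le> p34" "p34 \<le> 1"
    and f: "\<forall>a\<in>{1..MA}. f a \<in> bitvecs n" and g: "\<forall>b\<in>{1..MB}. g b \<in> bitvecs n"
    and "MA > 0" "MB > 0"
  defines "p' \<equiv> xor_crossover (xor_crossover p13 p23) p34"
  shows "bsc_error_prob p14 n MA f decA \<le> serial_error_prob p13 p14 p23 p34 n MA MB f g decA decB"
    and "bsc_error_prob p' n MB g decB \<le> serial_error_prob p13 p14 p23 p34 n MA MB f g decA decB"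
    and "serial_error_prob p13 p14 p23 p34 n MA MB f g decA decB
           \<le> bsc_error_prob p14 n MA f decA + bsc_error_prob p' n MB g decB"
proof -
  let ?E = "network_expectation p13 p14 p23 p34 n"
  define errA where "errA a e14 = (of_bool (decA (xorv (f a) e14) \<noteq> a) :: real)" for a e14
  define errB where "errB b e = (of_bool (decB (xorv (g b) e) \<noteq> b) :: real)" for b e
  define u where "u a = ?E (\<lambda>e13 e14 e23 e34. errA a e14)" for a
  define v where "v b = ?E (\<lambda>e13 e14 e23 e34. errB b (xorv (xorv e13 e23) e34))" for b
  define w where "w a b = ?E (\<lambda>e13 e14 e23 e34. max (errA a e14) (errB b (xorv (xorv e13 e23) e34)))"
    for a b
  have uvw: "u a \<le> w a b \<and> v b \<le> w a b \<and> w a b \<le> u a + v b" for a b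
    unfolding u_def v_def w_def network_expectation_add[symmetric]
    by (intro conjI network_expectation_mono p) (auto simp: errA_def errB_def)
  note bounds = double_average_bounds[of "{1..MA}" "{1..MB}" u w v, OF _ _ _ _ uvw]
  have "bsc_error_prob p14 n MA f decA = (\<Sum>a\<in>{1..MA}. u a) / card {1..MA}"
    by (simp add: bsc_error_prob_def u_def errA_def network_expectation_direct_link)
  moreover have "bsc_error_prob p' n MB g decB = (\<Sum>b\<in>{1..MB}. v b) / card {1..MB}"
    unfolding v_def network_expectation_relay by (simp add: bsc_error_prob_def errB_def p'_def)
  moreover have "serial_error_prob p13 p14 p23 p34 n MA MB f g decA decB
      = (\<Sum>a\<in>{1..MA}. \<Sum>b\<in>{1..MB}. w a b) / (card {1..MA} * card {1..MB})"
    by (simp add: serial_error_prob_eq[OF f g] w_def errA_def errB_def)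
  ultimately show "bsc_error_prob p14 n MA f decA \<le> serial_error_prob p13 p14 p23 p34 n MA MB f g decA decB"
    and "bsc_error_prob p' n MB g decB \<le> serial_error_prob p13 p14 p23 p34 n MA MB f g decA decB"
    and "serial_error_prob p13 p14 p23 p34 n MA MB f g decA decB
           \<le> bsc_error_prob p14 n MA f decA + bsc_error_prob p' n MB g decB"
    using bounds \<open>MA > 0\<close> \<open>MB > 0\<close> by auto
qed

definition good_serial_code ::
  "real \<Rightarrow> real \<Rightarrow> real \<Rightarrow> real \<Rightarrow> nat \<Rightarrow> nat \<Rightarrow> nat \<Rightarrow> real \<Rightarrow> bool" where
  "good_serial_code p13 p14 p23 p34 n MA MB \<epsilon> \<longleftrightarrow>
     (\<exists>f g decA decB. (\<forall>a\<in>{1..MA}. f a \<in> bitvecs n) \<and> (\<forall>b\<in>{1..MB}. g b \<in> bitvecs n) \<and>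
        serial_error_prob p13 p14 p23 p34 n MA MB f g decA decB \<le> \<epsilon>)"

lemma serial_achievable_iff:
  "serial_achievable p13 p14 p23 p34 (RA, RB) \<longleftrightarrow> 0 \<le> RA \<and> 0 \<le> RB \<and>
     (\<forall>\<epsilon>>0. \<forall>\<^sub>F n in sequentially.
        good_serial_code p13 p14 p23 p34 n (num_msgs n RA) (num_msgs n RB) \<epsilon>)"
  by (simp add: serial_achievable_def good_serial_code_def eventually_sequentially)

lemma good_serial_code_of_good_bsc_codes:
  assumes p: "0 \<le> p13" "p13 \<le> 1" "0 \<le> p14" "p14 \<le> 1" "0 \<le> p23" "p23 \<le> 1" "0 \<le> p34" "p34 \<le> 1"
    and "good_bsc_code p14 n MA \<epsilon>\<^sub>A" "good_bsc_code (xor_crossover (xor_crossover p13 p23) p34) n MB \<epsilon>\<^sub>B"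
    and "MA > 0" "MB > 0"
  shows "good_serial_code p13 p14 p23 p34 n MA MB (\<epsilon>\<^sub>A + \<epsilon>\<^sub>B)"
proof -
  obtain f decA g decB where
    f: "\<forall>a\<in>{1..MA}. f a \<in> bitvecs n" "bsc_error_prob p14 n MA f decA \<le> \<epsilon>\<^sub>A" and
    g: "\<forall>b\<in>{1..MB}. g b \<in> bitvecs n"
      "bsc_error_prob (xor_crossover (xor_crossover p13 p23) p34) n MB g decB \<le> \<epsilon>\<^sub>B"
    using assms(9,10) unfolding good_bsc_code_def by blast
  have "serial_error_prob p13 p14 p23 p34 n MA MB f g decA decB \<le> \<epsilon>\<^sub>A + \<epsilon>\<^sub>B"
    using serial_error_prob_bounds(3)[OF p f(1) g(1) \<open>MA > 0\<close> \<open>MB > 0\<close>, of decA decB] f(2) g(2)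
    by linarith
  with f(1) g(1) show ?thesis
    unfolding good_serial_code_def by blast
qed

lemma good_bsc_codes_of_good_serial_code:
  assumes p: "0 \<le> p13" "p13 \<le> 1" "0 \<le> p14" "p14 \<le> 1" "0 \<le> p23" "p23 \<le> 1" "0 \<le> p34" "p34 \<le> 1"
    and "good_serial_code p13 p14 p23 p34 n MA MB \<epsilon>" and "MA > 0" "MB > 0"
  shows "good_bsc_code p14 n MA \<epsilon>" "good_bsc_code (xor_crossover (xor_crossover p13 p23) p34) n MB \<epsilon>"
proof -
  obtain f g decA decB where f: "\<forall>a\<in>{1..MA}. f a \<in> bitvecs n" and g: "\<forall>b\<in>{1..MB}. g b \<in> bitvecs n"
    and err: "serial_error_prob p13 p14 p23 p34 n MA MB f g decA decB \<le> \<epsilon>"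
    using assms(9) unfolding good_serial_code_def by blast
  note bounds = serial_error_prob_bounds(1,2)[OF p f g \<open>MA > 0\<close> \<open>MB > 0\<close>, where decA=decA and decB=decB]
  show "good_bsc_code p14 n MA \<epsilon>"
    unfolding good_bsc_code_def using bounds(1) err f by (intro exI[of _ f] exI[of _ decA]) auto
  show "good_bsc_code (xor_crossover (xor_crossover p13 p23) p34) n MB \<epsilon>"
    unfolding good_bsc_code_def using bounds(2) err g by (intro exI[of _ g] exI[of _ decB]) auto
qed

lemma xor_crossover_relay_bounds:
  assumes "0 \<le> p13" "p13 \<le> 1" "0 \<le> p23" "p23 \<le> 1" "0 \<le> p34" "p34 \<le> 1"
  shows "0 \<le> xor_crossover (xor_crossover p13 p23) p34" "xor_crossover (xor_crossover p13 p23) p34 \<le> 1"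
  using assms by (intro xor_crossover_bounds; simp add: xor_crossover_bounds)+

lemma good_bsc_code_eventually:
  assumes "0 \<le> p" "p \<le> 1" "0 \<le> R" "R = 0 \<or> R < bsc_capacity p" "\<epsilon> > 0"
  shows "\<forall>\<^sub>F n in sequentially. good_bsc_code p n (num_msgs n R) \<epsilon>"
  using assms good_bsc_code_rate_zero good_bsc_code_below_capacity by auto

lemma serial_achievable_below_capacities:
  assumes p: "0 \<le> p13" "p13 \<le> 1" "0 \<le> p14" "p14 \<le> 1" "0 \<le> p23" "p23 \<le> 1" "0 \<le> p34" "p34 \<le> 1"
    and RA: "0 \<le> RA" "RA = 0 \<or> RA < bsc_capacity p14"
    and RB: "0 \<le> RB" "RB = 0 \<or> RB < bsc_capacity (xor_crossover (xor_crossover p13 p23) p34)"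
  shows "serial_achievable p13 p14 p23 p34 (RA, RB)"
  unfolding serial_achievable_iff
proof (intro conjI RA(1) RB(1) allI impI)
  fix \<epsilon> :: real assume "\<epsilon> > 0"
  let ?p' = "xor_crossover (xor_crossover p13 p23) p34"
  have "\<forall>\<^sub>F n in sequentially. good_bsc_code p14 n (num_msgs n RA) (\<epsilon> / 2)
                               \<and> good_bsc_code ?p' n (num_msgs n RB) (\<epsilon> / 2)"
    using \<open>\<epsilon> > 0\<close> RA RB p xor_crossover_relay_bounds[of p13 p23 p34]
    by (intro eventually_conj good_bsc_code_eventually) auto
  then show "\<forall>\<^sub>F n in sequentially. good_serial_code p13 p14 p23 p34 n (num_msgs n RA) (num_msgs n RB) \<epsilon>"
    by eventually_elim
      (use good_serial_code_of_good_bsc_codes[OF p _ _ num_msgs_pos[OF RA(1)] num_msgs_pos[OF RB(1)]]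
        in fastforce)
qed

lemma serial_achievable_le_capacities:
  assumes p: "0 \<le> p13" "p13 \<le> 1" "0 \<le> p14" "p14 \<le> 1" "0 \<le> p23" "p23 \<le> 1" "0 \<le> p34" "p34 \<le> 1"
    and "serial_achievable p13 p14 p23 p34 (RA, RB)"
  shows "RA \<le> bsc_capacity p14" "RB \<le> bsc_capacity (xor_crossover (xor_crossover p13 p23) p34)"
proof -
  let ?p' = "xor_crossover (xor_crossover p13 p23) p34"
  have R: "0 \<le> RA" "0 \<le> RB"
    and serial: "\<forall>\<^sub>F n in sequentially.
      good_serial_code p13 p14 p23 p34 n (num_msgs n RA) (num_msgs n RB) (1 / 2)"
    using assms(9) unfolding serial_achievable_iff by auto
  from serial have "\<forall>\<^sub>F n in sequentially. good_bsc_code p14 n (num_msgs n RA) (1 / 2)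
                                 \<and> good_bsc_code ?p' n (num_msgs n RB) (1 / 2)"
    by eventually_elim
      (use good_bsc_codes_of_good_serial_code[OF p _ num_msgs_pos[OF R(1)] num_msgs_pos[OF R(2)]]
        in blast)
  then have "\<exists>\<^sub>F n in sequentially. good_bsc_code p14 n (num_msgs n RA) (1 / 2)"
    and "\<exists>\<^sub>F n in sequentially. good_bsc_code ?p' n (num_msgs n RB) (1 / 2)"
    by (auto intro: eventually_frequently elim: eventually_mono)
  then show "RA \<le> bsc_capacity p14" "RB \<le> bsc_capacity ?p'"
    using rate_le_bsc_capacity p xor_crossover_relay_bounds[of p13 p23 p34] R by blast+
qed

lemma rectangle_subset_closure:
  fixes S :: "(real \<times> real) set"
  assumes "\<And>x y. 0 \<le> x \<Longrightarrow> 0 \<le> y \<Longrightarrow> x = 0 \<or> x < a \<Longrightarrow> y = 0 \<or> y < b \<Longrightarrow> (x, y) \<in> S"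
  shows "{0..a} \<times> {0..b} \<subseteq> closure S"
proof
  fix z assume "z \<in> {0..a} \<times> {0..b}"
  then obtain x y where z: "z = (x, y)" "0 \<le> x" "x \<le> a" "0 \<le> y" "y \<le> b"
    by auto
  define c where "c k = 1 - inverse (real (Suc k))" for k
  have c: "0 \<le> c k" "c k < 1" for k
    by (auto simp: c_def field_simps)
  have shrink: "c k * v = 0 \<or> c k * v < w" if "0 \<le> v" "v \<le> w" for v w k
  proof (cases "v = 0")
    case False
    then have "c k * v < v"
      using that c[of k] by (simp add: mult_less_cancel_right2)
    then show ?thesis
      using that by simp
  qed simp
  have "c \<longlonglongrightarrow> 1 - 0"
    unfolding c_def by (intro tendsto_diff tendsto_const LIMSEQ_inverse_real_of_nat)
  then have "(\<lambda>k. (c k * x, c k * y)) \<longlonglongrightarrow> (1 * x, 1 * y)"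
    by (intro tendsto_Pair tendsto_mult tendsto_const) simp_all
  moreover have "(c k * x, c k * y) \<in> S" for k
    using z c shrink by (intro assms) auto
  ultimately show "z \<in> closure S"
    unfolding closure_sequential z(1) by (intro exI[of _ "\<lambda>k. (c k * x, c k * y)"]) auto
qed

theorem theorem2:
  fixes p13 p14 p23 p34 :: real
  assumes "0 \<le> p13" "p13 \<le> 1" "0 \<le> p14" "p14 \<le> 1"
      and "0 \<le> p23" "p23 \<le> 1" "0 \<le> p34" "p34 \<le> 1"
  defines "p' \<equiv> ((1 - p13) * (1 - p23) + p13 * p23) * p34
                + (p13 * (1 - p23) + (1 - p13) * p23) * (1 - p34)"
  shows "serial_region p13 p14 p23 p34 =
         convex hull {(RA, RB). 0 \<le> RA \<and> 0 \<le> RB \<and>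
                                RA \<le> bsc_capacity p14 \<and> RB \<le> bsc_capacity p'}"
proof -
  have p': "p' = xor_crossover (xor_crossover p13 p23) p34"
    unfolding p'_def xor_crossover_def by (simp add: algebra_simps)
  let ?achievable = "{R. serial_achievable p13 p14 p23 p34 R}"
  let ?box = "{0..bsc_capacity p14} \<times> {0..bsc_capacity p'}"
  have "(RA, RB) \<in> ?box" if "serial_achievable p13 p14 p23 p34 (RA, RB)" for RA RB
    using serial_achievable_le_capacities[OF assms(1-8) that] that
    unfolding p' serial_achievable_def by auto
  then have "?achievable \<subseteq> ?box"
    by (intro subsetI) (metis CollectD surj_pair)
  then have "closure ?achievable \<subseteq> ?box"
    by (intro closure_minimal closed_Times) auto
  moreover have "?box \<subseteq> closure ?achievable"
    by (rule rectangle_subset_closure) (auto intro: serial_achievable_below_capacities[OF assms(1-8)] simp: p')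
  moreover have "convex hull ?box = ?box"
    by (intro convex_hull_eq[THEN iffD2] convex_Times) auto
  moreover have "{(RA, RB). 0 \<le> RA \<and> 0 \<le> RB \<and> RA \<le> bsc_capacity p14 \<and> RB \<le> bsc_capacity p'} = ?box"
    by auto
  ultimately show ?thesis
    unfolding serial_region_def by simp
qed

end
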